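(* For every integer $q\geq1$, the small Coppersmith–Winograd tensor $$\mathrm{cw}_q:=\sum_{i=1}^q\bigl(e_0\otimes e_i\otimes e_i+e_i\otimes e_0\otimes e_i+e_i\otimes e_i\otimes e_0\bigr)\in\mathbb{F}^{q+1}\otimes\mathbb{F}^{q+1}\otimes\mathbb{F}^{q+1}$$ (with basis $e_0,\dots,e_q$) satisfies $$2\,\mathrm{irr}(\mathrm{cw}_q)\geq\frac{2\log_2(q+1)}{\log_2 3-\tfrac23+\tfrac23\log_2 q}.$$
   Context: Tensors are 3-tensors over a fixed field $\mathbb{F}$. Write $t\geq s$ if there are linear maps $A_i$ with $(A_1\otimes A_2\otimes A_3)t=s$; $\langle n\rangle:=\sum_{i=1}^n e_i\otimes e_i\otimes e_i$; relative exponent $\omega(t,s):=\lim_{n\to\infty}\frac1n\min\{m\in\mathbb{N}: t^{\otimes m}\geq s^{\otimes n}\}$ (tensor powers regarded as 3-tensors by grouping factors); irreversibility $\mathrm{irr}(t):=\omega(\langle2\rangle,t)\,\omega(t,\langle2\rangle)$, equivalently $\log_2$ of the asymptotic rank $\lim_n \mathrm{R}(t^{\otimes n})^{1/n}$ divided by $\log_2$ of the asymptotic subrank $\lim_n\mathrm{Q}(t^{\otimes n})^{1/n}$, where $\mathrm{R}(t)=\min\{n:t\leq\langle n\rangle\}$ and $\mathrm{Q}(t)=\max\{n:\langle n\rangle\leq t\}$. *)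

theory Defs
  imports Complex_Main "HOL-Library.Extended_Real"
begin

text \<open>
  A 3-tensor in \<open>F\<^sup>I \<otimes> F\<^sup>J \<otimes> F\<^sup>K\<close> is given by its three index sets \<open>I\<close>, \<open>J\<close>, \<open>K\<close>
  and its coefficients with respect to the standard bases. The index sets are meant to be finite
  (they are for all tensors below, and tensor powers preserve this); values of the coefficient
  function outside \<open>I \<times> J \<times> K\<close> are irrelevant.
\<close>

record ('a, 'f) tensor3 =
  idx1 :: "'a set"
  idx2 :: "'a set"
  idx3 :: "'a set"
  coef :: "'a \<Rightarrow> 'a \<Rightarrow> 'a \<Rightarrow> 'f"

text \<open>
  \<open>t \<ge> s\<close>: linear maps \<open>A1, A2, A3\<close> between the coordinate spaces, given by their matrices
  (first argument the row, i.e. the target index), satisfy \<open>(A1 \<otimes> A2 \<otimes> A3) t = s\<close>.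
\<close>

definition restricts_to ::
  "('a, 'f::field) tensor3 \<Rightarrow> ('b, 'f) tensor3 \<Rightarrow> bool" (infix "\<succeq>" 50) where
  "t \<succeq> s \<longleftrightarrow>
    (\<exists>A1 A2 A3 :: 'b \<Rightarrow> 'a \<Rightarrow> 'f.
      \<forall>i'\<in>idx1 s. \<forall>j'\<in>idx2 s. \<forall>k'\<in>idx3 s.
        (\<Sum>i\<in>idx1 t. \<Sum>j\<in>idx2 t. \<Sum>k\<in>idx3 t.
          A1 i' i * A2 j' j * A3 k' k * coef t i j k) = coef s i' j' k')"

text \<open>
  The \<open>n\<close>-th tensor power, regarded as a 3-tensor: the basis of \<open>(F\<^sup>I)\<close> tensored with itself
  \<open>n\<close> times is indexed by the lists of length \<open>n\<close> over \<open>I\<close>.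
\<close>

definition tensor_power ::
  "('a, 'f::field) tensor3 \<Rightarrow> nat \<Rightarrow> ('a list, 'f) tensor3" where
  "tensor_power t n =
    \<lparr> idx1 = {xs. length xs = n \<and> set xs \<subseteq> idx1 t},
      idx2 = {ys. length ys = n \<and> set ys \<subseteq> idx2 t},
      idx3 = {zs. length zs = n \<and> set zs \<subseteq> idx3 t},
      coef = (\<lambda>xs ys zs. \<Prod>l<n. coef t (xs ! l) (ys ! l) (zs ! l)) \<rparr>"

definition basis_vec :: "nat \<Rightarrow> nat \<Rightarrow> 'f::field" where
  "basis_vec i = (\<lambda>a. if a = i then 1 else 0)"

definition basis_tensor :: "nat \<Rightarrow> nat \<Rightarrow> nat \<Rightarrow> nat \<Rightarrow> nat \<Rightarrow> nat \<Rightarrow> 'f::field" where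
  "basis_tensor i j k = (\<lambda>a b c. basis_vec i a * basis_vec j b * basis_vec k c)"

definition unit_tensor :: "nat \<Rightarrow> (nat, 'f::field) tensor3" where
  "unit_tensor n =
    \<lparr> idx1 = {1..n}, idx2 = {1..n}, idx3 = {1..n},
      coef = (\<lambda>a b c. \<Sum>i=1..n. basis_tensor i i i a b c) \<rparr>"

definition cw :: "nat \<Rightarrow> (nat, 'f::field) tensor3" where
  "cw q =
    \<lparr> idx1 = {0..q}, idx2 = {0..q}, idx3 = {0..q},
      coef = (\<lambda>a b c. \<Sum>i=1..q.
        basis_tensor 0 i i a b c + basis_tensor i 0 i a b c + basis_tensor i i 0 a b c) \<rparr>"

text \<open>
  The infimum over a set of naturals is its minimum, and \<open>\<infinity>\<close> if no power of \<open>t\<close> restricts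
  to the given power of \<open>s\<close>.
\<close>

definition relative_exponent ::
  "('a, 'f::field) tensor3 \<Rightarrow> ('b, 'f) tensor3 \<Rightarrow> ereal" where
  "relative_exponent t s =
    lim (\<lambda>n. (INF m\<in>{m. tensor_power t m \<succeq> tensor_power s n}. ereal (real m)) / ereal (real n))"

definition irr :: "('a, 'f::field) tensor3 \<Rightarrow> ereal" where
  "irr t = relative_exponent (unit_tensor 2) t * relative_exponent t (unit_tensor 2)"

end

theory Submission
  imports Defs
begin

text \<open>
  The first flattening of \<open>cw q\<close> has full rank \<open>q + 1\<close> and flattening ranks multiply under tensor
  powers, which bounds the asymptotic rank from below. The asymptotic subrank is bounded from above
  by the asymptotic slice rank: give the index \<open>0\<close> weight \<open>u\<^sup>2\<close> and every other index weight
  \<open>1 / u\<close>, so that the weights of each support triple multiply to 1. In a support triple of the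
  \<open>m\<close>-th power some word then has weight at least 1, and there are at most \<open>(u\<^sup>2 + q / u)\<^sup>m\<close> such
  words in each direction. The optimal choice \<open>u\<^sup>3 = q / 2\<close> gives \<open>(3 (q / 2)\<^bsup>2/3\<^esup>)\<^sup>m\<close>.
\<close>

section \<open>Linear algebra: kernels of matrices and slice rank of diagonal tensors\<close>

text \<open>Gaussian elimination, one column at a time: a pivot row \<open>p\<close> clears its
  column and is dropped, so each column costs at most one row.\<close>

lemma left_kernel_nontrivial:
  fixes A :: "'a \<Rightarrow> 'b \<Rightarrow> 'f::field"
  assumes "finite C" "finite R" "card C < card R"
  shows "\<exists>c. (\<exists>i\<in>R. c i \<noteq> 0) \<and> (\<forall>j\<in>C. (\<Sum>i\<in>R. c i * A i j) = 0)"
  using assms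
proof (induction C arbitrary: A R rule: finite_induct)
  case empty
  then have "R \<noteq> {}" by auto
  then show ?case by (intro exI[of _ "\<lambda>_. 1"]) auto
next
  case (insert j C)
  show ?case
  proof (cases "\<forall>i\<in>R. A i j = 0")
    case True
    have "card C < card R" using insert by simp
    from insert.IH[OF insert.prems(1) this, of A] obtain c where
      "\<exists>i\<in>R. c i \<noteq> 0" "\<forall>j\<in>C. (\<Sum>i\<in>R. c i * A i j) = 0" by blast
    then show ?thesis using True by (intro exI[of _ c]) auto
  next
    case False
    then obtain p where p: "p \<in> R" "A p j \<noteq> 0" by blast
    define A' where "A' i k = A i k - A i j / A p j * A p k" for i k
    have "finite (R - {p})" "card C < card (R - {p})"
      using insert p by auto
    from insert.IH[OF this, of A'] obtain c where
      c: "\<exists>i\<in>R - {p}. c i \<noteq> 0" "\<And>k. k \<in> C \<Longrightarrow> (\<Sum>i\<in>R - {p}. c i * A' i k) = 0" by blast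
    \<comment> \<open>The weight at \<open>p\<close> collects the multiples of the pivot row that
      elimination subtracted, so \<open>d\<close> combines the rows of \<open>A\<close> exactly as
      \<open>c\<close> combines those of \<open>A'\<close>. Column \<open>j\<close> of
      \<open>A'\<close> is zero by construction.\<close>
    define d where "d = c(p := - (\<Sum>i\<in>R - {p}. c i * (A i j / A p j)))"
    have sum_d: "(\<Sum>i\<in>R. d i * A i k) = (\<Sum>i\<in>R - {p}. c i * A' i k)" for k
    proof -
      have "(\<Sum>i\<in>R. d i * A i k) = d p * A p k + (\<Sum>i\<in>R - {p}. d i * A i k)"
        using insert.prems(1) p(1) by (rule sum.remove)
      also have "(\<Sum>i\<in>R - {p}. d i * A i k) = (\<Sum>i\<in>R - {p}. c i * A i k)"
        by (intro sum.cong) (auto simp: d_def)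
      finally show ?thesis
        by (simp add: d_def A'_def algebra_simps sum_subtractf sum_distrib_left sum_distrib_right)
    qed
    have "(\<Sum>i\<in>R. d i * A i k) = 0" if "k \<in> insert j C" for k
      using that c(2) p(2) unfolding sum_d by (auto simp: A'_def)
    moreover have "\<exists>i\<in>R. d i \<noteq> 0" using c(1) by (auto simp: d_def)
    ultimately show ?thesis by blast
  qed
qed

text \<open>A vector of maximal support works: otherwise some solution vanishing on its support
  could be added to it.\<close>

lemma left_kernel_large_support:
  fixes A :: "'a \<Rightarrow> 'b \<Rightarrow> 'f::field"
  assumes "finite C" "finite R"
  shows "\<exists>h. card R \<le> card C + card {i\<in>R. h i \<noteq> 0} \<and> (\<forall>j\<in>C. (\<Sum>i\<in>R. h i * A i j) = 0)"
proof -
  define Q where "Q h \<longleftrightarrow> (\<forall>j\<in>C. (\<Sum>i\<in>R. h i * A i j) = 0)" for h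
  define supp where "supp h = {i\<in>R. h i \<noteq> 0}" for h :: "'a \<Rightarrow> 'f"
  have fin: "finite (supp h)" for h using assms(2) by (simp add: supp_def)
  have "Q (\<lambda>_. 0)" by (simp add: Q_def)
  moreover have "\<forall>h. Q h \<longrightarrow> card (supp h) < Suc (card R)"
    using assms(2) by (auto simp: supp_def less_Suc_eq_le intro!: card_mono)
  ultimately obtain h where h: "Q h" and max: "\<And>h'. Q h' \<Longrightarrow> card (supp h') \<le> card (supp h)"
    using ex_has_greatest_nat[of Q "\<lambda>_. 0" "\<lambda>h. card (supp h)" "Suc (card R)"]
    by (metis less_imp_le_nat)
  have "card R \<le> card C + card (supp h)"
  proof (rule ccontr)
    assume "\<not> ?thesis"
    \<comment> \<open>The columns of \<open>A\<close> are joined with one unit column per index in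
      the support of \<open>h\<close>; orthogonality to a unit column means vanishing at its
      index.\<close>
    then have "card (C <+> supp h) < card R" using assms(1) fin by (simp add: card_Plus)
    moreover have "finite (C <+> supp h)" using assms(1) fin by simp
    ultimately have "\<exists>c. (\<exists>i\<in>R. c i \<noteq> 0) \<and>
        (\<forall>j\<in>C <+> supp h. (\<Sum>i\<in>R. c i * (case j of Inl j \<Rightarrow> A i j | Inr k \<Rightarrow> if i = k then 1 else 0)) = 0)"
      using assms(2) by (intro left_kernel_nontrivial)
    then obtain c where c: "\<exists>i\<in>R. c i \<noteq> 0" and
      orth: "\<And>j. j \<in> C <+> supp h \<Longrightarrow>
        (\<Sum>i\<in>R. c i * (case j of Inl j \<Rightarrow> A i j | Inr k \<Rightarrow> if i = k then 1 else 0)) = 0"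
      by blast
    have "Q c" unfolding Q_def using orth[OF InlI] by simp
    have zero: "c k = 0" if "k \<in> supp h" for k
    proof -
      have "(\<Sum>i\<in>R. c i * (if i = k then 1 else 0)) = 0" using orth[OF InrI[OF that]] by simp
      then show ?thesis using that assms(2) by (simp add: supp_def if_distrib sum.delta cong: if_cong)
    qed
    obtain i where i: "i \<in> R" "c i \<noteq> 0" using c by blast
    have "Q (\<lambda>i. h i + c i)"
      using h \<open>Q c\<close> by (simp add: Q_def algebra_simps sum.distrib)
    moreover have "insert i (supp h) \<subseteq> supp (\<lambda>i. h i + c i)"
      using i zero by (force simp: supp_def)
    then have "card (insert i (supp h)) \<le> card (supp (\<lambda>i. h i + c i))"
      using fin by (rule card_mono[rotated])
    moreover have "i \<notin> supp h" using i zero by blast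
    ultimately show False using max[of "\<lambda>i. h i + c i"] fin[of h] by simp
  qed
  then show ?thesis using h unfolding Q_def supp_def by blast
qed

text \<open>Tao's lemma on the slice rank of a diagonal tensor.\<close>

lemma diagonal_slice_rank:
  fixes f1 :: "'w \<Rightarrow> 'a \<Rightarrow> 'f::field" and f2 :: "'w \<Rightarrow> 'b \<Rightarrow> 'f" and f3 :: "'w \<Rightarrow> 'c \<Rightarrow> 'f"
  assumes fin: "finite W" "finite S1" "finite S2" "finite S3"
    and diag: "\<And>x y z. x \<in> W \<Longrightarrow> y \<in> W \<Longrightarrow> z \<in> W \<Longrightarrow>
      (\<Sum>a\<in>S1. f1 x a * g1 a y z) + (\<Sum>a\<in>S2. f2 y a * g2 a x z) + (\<Sum>a\<in>S3. f3 z a * g3 a x y)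
        = (if x = y \<and> y = z then 1 else 0)"
  shows "card W \<le> card S1 + card S2 + card S3"
proof -
  \<comment> \<open>Contracting the first index with \<open>h\<close> kills all slices in the first
    direction, and \<open>h\<close> still vanishes at no more than \<open>card S1\<close> elements
    of \<open>W\<close>.\<close>
  obtain h where h: "card W \<le> card S1 + card {i\<in>W. h i \<noteq> 0}"
    and orth: "\<And>a. a \<in> S1 \<Longrightarrow> (\<Sum>x\<in>W. h x * f1 x a) = 0"
    using left_kernel_large_support[OF fin(2,1), of f1] by blast
  define Y where "Y = {i\<in>W. h i \<noteq> 0}"
  have Y: "finite Y" "Y \<subseteq> W" using fin(1) by (auto simp: Y_def)
  define G2 where "G2 a z = (\<Sum>x\<in>W. h x * g2 a x z)" for a z
  define G3 where "G3 a y = (\<Sum>x\<in>W. h x * g3 a x y)" for a y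
  \<comment> \<open>The contraction turns the diagonal tensor into the diagonal matrix with entries
    \<open>h y\<close>, now a sum of \<open>card S2 + card S3\<close> matrices of rank at most
    one.\<close>
  have contracted: "(\<Sum>a\<in>S2. f2 y a * G2 a z) + (\<Sum>a\<in>S3. f3 z a * G3 a y) = (if y = z then h y else 0)"
    if "y \<in> W" "z \<in> W" for y z
  proof -
    have "(\<Sum>x\<in>W. h x * (if x = y \<and> y = z then 1 else 0)) = (if y = z then h y else 0)"
      using that fin(1) by (simp add: if_distrib sum.delta cong: if_cong)
    moreover have "(\<Sum>x\<in>W. h x * (if x = y \<and> y = z then 1 else 0)) =
      (\<Sum>x\<in>W. h x * ((\<Sum>a\<in>S1. f1 x a * g1 a y z) + (\<Sum>a\<in>S2. f2 y a * g2 a x z) + (\<Sum>a\<in>S3. f3 z a * g3 a x y)))"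
      using diag[OF _ that] by simp
    moreover have "\<dots> = (\<Sum>x\<in>W. \<Sum>a\<in>S1. h x * f1 x a * g1 a y z)
        + (\<Sum>x\<in>W. \<Sum>a\<in>S2. f2 y a * (h x * g2 a x z)) + (\<Sum>x\<in>W. \<Sum>a\<in>S3. f3 z a * (h x * g3 a x y))"
      by (simp add: algebra_simps sum.distrib sum_distrib_left)
    moreover have "(\<Sum>x\<in>W. \<Sum>a\<in>S1. h x * f1 x a * g1 a y z) = (\<Sum>a\<in>S1. (\<Sum>x\<in>W. h x * f1 x a) * g1 a y z)"
      by (subst sum.swap) (simp add: sum_distrib_right)
    moreover have "\<dots> = 0" using orth by simp
    moreover have "(\<Sum>x\<in>W. \<Sum>a\<in>S2. f2 y a * (h x * g2 a x z)) = (\<Sum>a\<in>S2. f2 y a * G2 a z)"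
      unfolding G2_def by (subst sum.swap) (simp add: sum_distrib_left)
    moreover have "(\<Sum>x\<in>W. \<Sum>a\<in>S3. f3 z a * (h x * g3 a x y)) = (\<Sum>a\<in>S3. f3 z a * G3 a y)"
      unfolding G3_def by (subst sum.swap) (simp add: sum_distrib_left)
    ultimately show ?thesis by simp
  qed
  \<comment> \<open>On \<open>Y\<close> the diagonal matrix is invertible. With fewer rank-one terms
    than rows, some nonzero \<open>c\<close> would annihilate all their \<open>y\<close>-dependent
    factors, which are \<open>f2\<close> and \<open>G3\<close>, and hence the whole matrix.\<close>
  have "card Y \<le> card S2 + card S3"
  proof (rule ccontr)
    assume "\<not> ?thesis"
    then have "card (S2 <+> S3) < card Y" using fin by (simp add: card_Plus)
    moreover have "finite (S2 <+> S3)" using fin by simp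
    ultimately have "\<exists>c. (\<exists>i\<in>Y. c i \<noteq> 0) \<and>
        (\<forall>j\<in>S2 <+> S3. (\<Sum>i\<in>Y. c i * (case j of Inl a \<Rightarrow> f2 i a | Inr a \<Rightarrow> G3 a i)) = 0)"
      using Y(1) by (intro left_kernel_nontrivial)
    then obtain c where c: "\<exists>i\<in>Y. c i \<noteq> 0" and
      c0: "\<And>j. j \<in> S2 <+> S3 \<Longrightarrow> (\<Sum>i\<in>Y. c i * (case j of Inl a \<Rightarrow> f2 i a | Inr a \<Rightarrow> G3 a i)) = 0"
      by blast
    have c2: "(\<Sum>i\<in>Y. c i * f2 i a) = 0" if "a \<in> S2" for a using c0[OF InlI[OF that]] by simp
    have c3: "(\<Sum>i\<in>Y. c i * G3 a i) = 0" if "a \<in> S3" for a using c0[OF InrI[OF that]] by simp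
    obtain z where z: "z \<in> Y" "c z \<noteq> 0" using c by blast
    have "c z * h z = (\<Sum>y\<in>Y. c y * (if y = z then h y else 0))"
      using z Y by (simp add: if_distrib sum.delta cong: if_cong)
    also have "\<dots> = (\<Sum>y\<in>Y. c y * ((\<Sum>a\<in>S2. f2 y a * G2 a z) + (\<Sum>a\<in>S3. f3 z a * G3 a y)))"
      using contracted z Y(2) by (intro sum.cong refl) (simp add: subset_iff)
    also have "\<dots> = (\<Sum>y\<in>Y. \<Sum>a\<in>S2. c y * f2 y a * G2 a z) + (\<Sum>y\<in>Y. \<Sum>a\<in>S3. f3 z a * (c y * G3 a y))"
      by (simp add: algebra_simps sum.distrib sum_distrib_left)
    also have "(\<Sum>y\<in>Y. \<Sum>a\<in>S2. c y * f2 y a * G2 a z) = (\<Sum>a\<in>S2. (\<Sum>y\<in>Y. c y * f2 y a) * G2 a z)"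
      by (subst sum.swap) (simp add: sum_distrib_right)
    also have "(\<Sum>y\<in>Y. \<Sum>a\<in>S3. f3 z a * (c y * G3 a y)) = (\<Sum>a\<in>S3. f3 z a * (\<Sum>y\<in>Y. c y * G3 a y))"
      by (subst sum.swap) (simp add: sum_distrib_left)
    finally have "c z * h z = 0" using c2 c3 by simp
    then show False using z by (simp add: Y_def)
  qed
  then show ?thesis using h unfolding Y_def by simp
qed

section \<open>Obstructions to restriction: slice covers and flattening rank\<close>

text \<open>Linear maps on the three factors send slices to slices, so a cover of the support of
  \<open>t\<close> by slices yields a slice decomposition of \<open>s\<close> with equally many
  terms. Tao's lemma then applies, since \<open>s\<close> is diagonal.\<close>

lemma card_diagonal_le_slices:
  fixes t :: "('a, 'f::field) tensor3" and s :: "('b, 'f) tensor3"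
  assumes "t \<succeq> s"
    and fin: "finite (idx1 t)" "finite (idx2 t)" "finite (idx3 t)" "finite W"
    and idx: "idx1 s = W" "idx2 s = W" "idx3 s = W"
    and diag: "\<And>x y z. x \<in> W \<Longrightarrow> y \<in> W \<Longrightarrow> z \<in> W \<Longrightarrow>
      coef s x y z = (if x = y \<and> y = z then 1 else 0)"
    and cover: "\<And>x y z. x \<in> idx1 t \<Longrightarrow> y \<in> idx2 t \<Longrightarrow> z \<in> idx3 t \<Longrightarrow> coef t x y z \<noteq> 0 \<Longrightarrow>
      P1 x \<or> P2 y \<or> P3 z"
  shows "card W \<le> card {x\<in>idx1 t. P1 x} + card {y\<in>idx2 t. P2 y} + card {z\<in>idx3 t. P3 z}"
proof -
  from assms(1) obtain A1 A2 A3 where A0 [rule_format]: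
      "\<forall>x\<in>idx1 s. \<forall>y\<in>idx2 s. \<forall>z\<in>idx3 s.
      (\<Sum>i\<in>idx1 t. \<Sum>j\<in>idx2 t. \<Sum>k\<in>idx3 t. A1 x i * A2 y j * A3 z k * coef t i j k) = coef s x y z"
    unfolding restricts_to_def by (elim exE)
  note A = trans[OF A0[unfolded idx] diag]
  \<comment> \<open>Each support entry is credited to the first of \<open>P1\<close>,
    \<open>P2\<close>, \<open>P3\<close> that it satisfies, so that none is counted twice.\<close>
  define T1 where "T1 i j k = (if P1 i then coef t i j k else 0)" for i j k
  define T2 where "T2 i j k = (if \<not> P1 i \<and> P2 j then coef t i j k else 0)" for i j k
  define T3 where "T3 i j k = (if \<not> P1 i \<and> \<not> P2 j \<and> P3 k then coef t i j k else 0)" for i j k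
  have split: "coef t i j k = T1 i j k + T2 i j k + T3 i j k"
    if "i \<in> idx1 t" "j \<in> idx2 t" "k \<in> idx3 t" for i j k
    using cover[OF that] by (auto simp: T1_def T2_def T3_def)
  define g1 where "g1 i y z = (\<Sum>j\<in>idx2 t. \<Sum>k\<in>idx3 t. A2 y j * A3 z k * T1 i j k)" for i y z
  define g2 where "g2 j x z = (\<Sum>i\<in>idx1 t. \<Sum>k\<in>idx3 t. A1 x i * A3 z k * T2 i j k)" for j x z
  define g3 where "g3 k x y = (\<Sum>i\<in>idx1 t. \<Sum>j\<in>idx2 t. A1 x i * A2 y j * T3 i j k)" for k x y
  show ?thesis
  proof (rule diagonal_slice_rank[where ?f1.0 = A1 and ?f2.0 = A2 and ?f3.0 = A3
        and ?g1.0 = g1 and ?g2.0 = g2 and ?g3.0 = g3])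
    fix x y z assume W: "x \<in> W" "y \<in> W" "z \<in> W"
    have "(\<Sum>i\<in>idx1 t. \<Sum>j\<in>idx2 t. \<Sum>k\<in>idx3 t. A1 x i * A2 y j * A3 z k * T1 i j k)
        = (\<Sum>i\<in>idx1 t. A1 x i * g1 i y z)"
      by (simp add: g1_def sum_distrib_left mult.assoc)
    also have "\<dots> = (\<Sum>i\<in>{i\<in>idx1 t. P1 i}. A1 x i * g1 i y z)"
      by (rule sum.mono_neutral_right) (auto simp: fin g1_def T1_def)
    finally have e1: "(\<Sum>i\<in>idx1 t. \<Sum>j\<in>idx2 t. \<Sum>k\<in>idx3 t. A1 x i * A2 y j * A3 z k * T1 i j k) = \<dots>" .
    have "(\<Sum>i\<in>idx1 t. \<Sum>j\<in>idx2 t. \<Sum>k\<in>idx3 t. A1 x i * A2 y j * A3 z k * T2 i j k)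
        = (\<Sum>j\<in>idx2 t. \<Sum>i\<in>idx1 t. \<Sum>k\<in>idx3 t. A1 x i * A2 y j * A3 z k * T2 i j k)"
      by (rule sum.swap)
    also have "\<dots> = (\<Sum>j\<in>idx2 t. A2 y j * g2 j x z)"
      by (simp add: g2_def sum_distrib_left mult_ac)
    also have "\<dots> = (\<Sum>j\<in>{j\<in>idx2 t. P2 j}. A2 y j * g2 j x z)"
      by (rule sum.mono_neutral_right) (auto simp: fin g2_def T2_def)
    finally have e2: "(\<Sum>i\<in>idx1 t. \<Sum>j\<in>idx2 t. \<Sum>k\<in>idx3 t. A1 x i * A2 y j * A3 z k * T2 i j k) = \<dots>" .
    have "(\<Sum>i\<in>idx1 t. \<Sum>j\<in>idx2 t. \<Sum>k\<in>idx3 t. A1 x i * A2 y j * A3 z k * T3 i j k)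
        = (\<Sum>i\<in>idx1 t. \<Sum>k\<in>idx3 t. \<Sum>j\<in>idx2 t. A1 x i * A2 y j * A3 z k * T3 i j k)"
      by (intro sum.cong refl sum.swap)
    also have "\<dots> = (\<Sum>k\<in>idx3 t. \<Sum>i\<in>idx1 t. \<Sum>j\<in>idx2 t. A1 x i * A2 y j * A3 z k * T3 i j k)"
      by (rule sum.swap)
    also have "\<dots> = (\<Sum>k\<in>idx3 t. A3 z k * g3 k x y)"
      by (simp add: g3_def sum_distrib_left mult_ac)
    also have "\<dots> = (\<Sum>k\<in>{k\<in>idx3 t. P3 k}. A3 z k * g3 k x y)"
      by (rule sum.mono_neutral_right) (auto simp: fin g3_def T3_def)
    finally have e3: "(\<Sum>i\<in>idx1 t. \<Sum>j\<in>idx2 t. \<Sum>k\<in>idx3 t. A1 x i * A2 y j * A3 z k * T3 i j k) = \<dots>" .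
    have "(\<Sum>i\<in>idx1 t. \<Sum>j\<in>idx2 t. \<Sum>k\<in>idx3 t. A1 x i * A2 y j * A3 z k * coef t i j k)
      = (\<Sum>i\<in>idx1 t. \<Sum>j\<in>idx2 t. \<Sum>k\<in>idx3 t. A1 x i * A2 y j * A3 z k * T1 i j k
          + A1 x i * A2 y j * A3 z k * T2 i j k + A1 x i * A2 y j * A3 z k * T3 i j k)"
      by (intro sum.cong refl) (simp add: split distrib_left)
    then show "(\<Sum>i\<in>{i\<in>idx1 t. P1 i}. A1 x i * g1 i y z) + (\<Sum>j\<in>{j\<in>idx2 t. P2 j}. A2 y j * g2 j x z)
        + (\<Sum>k\<in>{k\<in>idx3 t. P3 k}. A3 z k * g3 k x y) = (if x = y \<and> y = z then 1 else 0)"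
      using A[OF W W] by (simp add: sum.distrib e1 e2 e3)
  qed (use fin in auto)
qed

text \<open>The first flattening of \<open>s\<close> factors through \<open>A1\<close>, so its rank
  is at most \<open>card (idx1 t)\<close>. The pivots make its rows independent: for every row
  \<open>x\<close> some column has its only nonzero entry there.\<close>

lemma card_idx1_le_of_restricts:
  fixes t :: "('a, 'f::field) tensor3" and s :: "('b, 'f) tensor3"
  assumes "t \<succeq> s" and fin: "finite (idx1 t)" "finite (idx1 s)"
    and pivot: "\<And>x. x \<in> idx1 s \<Longrightarrow> \<exists>y\<in>idx2 s. \<exists>z\<in>idx3 s.
      coef s x y z \<noteq> 0 \<and> (\<forall>x'\<in>idx1 s. x' \<noteq> x \<longrightarrow> coef s x' y z = 0)"
  shows "card (idx1 s) \<le> card (idx1 t)"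
proof (rule ccontr)
  assume "\<not> ?thesis"
  then have less: "card (idx1 t) < card (idx1 s)" by simp
  from assms(1) obtain A1 A2 A3 where A [rule_format]:
      "\<forall>x\<in>idx1 s. \<forall>y\<in>idx2 s. \<forall>z\<in>idx3 s.
      (\<Sum>i\<in>idx1 t. \<Sum>j\<in>idx2 t. \<Sum>k\<in>idx3 t. A1 x i * A2 y j * A3 z k * coef t i j k) = coef s x y z"
    unfolding restricts_to_def by (elim exE)
  obtain c x where x: "x \<in> idx1 s" "c x \<noteq> 0"
    and c: "\<And>i. i \<in> idx1 t \<Longrightarrow> (\<Sum>x\<in>idx1 s. c x * A1 x i) = 0"
    using left_kernel_nontrivial[OF fin less, of A1] by blast
  obtain y z where yz: "y \<in> idx2 s" "z \<in> idx3 s" "coef s x y z \<noteq> 0"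
    "\<And>x'. x' \<in> idx1 s \<Longrightarrow> x' \<noteq> x \<Longrightarrow> coef s x' y z = 0" using pivot[OF x(1)] by blast
  define D where "D i = (\<Sum>j\<in>idx2 t. \<Sum>k\<in>idx3 t. A2 y j * A3 z k * coef t i j k)" for i
  have "c x * coef s x y z = (\<Sum>x'\<in>idx1 s. if x' = x then c x' * coef s x' y z else 0)"
    using x fin(2) by (simp add: sum.delta)
  also have "\<dots> = (\<Sum>x'\<in>idx1 s. c x' * coef s x' y z)"
    using yz(4) by (intro sum.cong) auto
  also have "\<dots> = (\<Sum>x'\<in>idx1 s. \<Sum>i\<in>idx1 t. c x' * A1 x' i * D i)"
    using yz(1,2) by (intro sum.cong refl) (simp add: A[symmetric] D_def sum_distrib_left mult.assoc)
  also have "\<dots> = (\<Sum>i\<in>idx1 t. (\<Sum>x'\<in>idx1 s. c x' * A1 x' i) * D i)"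
    by (subst sum.swap) (simp add: sum_distrib_right)
  also have "\<dots> = 0" using c by simp
  finally show False using x yz by simp
qed

section \<open>Tensor powers as tensors indexed by words\<close>

lemma tensor_power_simps [simp]:
  "idx1 (tensor_power t n) = {xs. length xs = n \<and> set xs \<subseteq> idx1 t}"
  "idx2 (tensor_power t n) = {xs. length xs = n \<and> set xs \<subseteq> idx2 t}"
  "idx3 (tensor_power t n) = {xs. length xs = n \<and> set xs \<subseteq> idx3 t}"
  "coef (tensor_power t n) xs ys zs = (\<Prod>l<n. coef t (xs ! l) (ys ! l) (zs ! l))"
  by (simp_all add: tensor_power_def)

lemma finite_lists_length: "finite A \<Longrightarrow> finite {xs. length xs = n \<and> set xs \<subseteq> A}"
  using finite_lists_length_eq[of A n] by (simp add: conj_commute)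

lemma card_lists_length: "finite A \<Longrightarrow> card {xs. length xs = n \<and> set xs \<subseteq> A} = card A ^ n"
  using card_lists_length_eq[of A n] by (simp add: conj_commute)

text \<open>Multiplying out the power of a sum gives one term per word. This evaluates the total
  weight of all words in the subrank bound.\<close>

lemma sum_lists_prod_list:
  fixes g :: "'a \<Rightarrow> 'b::comm_semiring_1"
  shows "(\<Sum>xs | length xs = n \<and> set xs \<subseteq> A. prod_list (map g xs)) = sum g A ^ n"
proof (induction n)
  case 0
  have "{xs. xs = [] \<and> set xs \<subseteq> A} = {[]}" by auto
  then show ?case by simp
next
  case (Suc n)
  have "(\<Sum>xs | length xs = Suc n \<and> set xs \<subseteq> A. prod_list (map g xs))
      = (\<Sum>(x, xs)\<in>A \<times> {xs. length xs = n \<and> set xs \<subseteq> A}. g x * prod_list (map g xs))"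
    by (rule sum.reindex_bij_witness[of _ "\<lambda>(x, xs). x # xs" "\<lambda>xs. (hd xs, tl xs)"])
       (auto simp: length_Suc_conv)
  also have "\<dots> = sum g A * (\<Sum>xs | length xs = n \<and> set xs \<subseteq> A. prod_list (map g xs))"
    by (simp add: sum_product sum.cartesian_product)
  finally show ?case using Suc by simp
qed

lemma prod_lessThan_add:
  fixes f :: "nat \<Rightarrow> 'a::comm_monoid_mult"
  shows "(\<Prod>l<a + b. f l) = (\<Prod>l<a. f l) * (\<Prod>l<b. f (a + l))"
  by (induction b) (simp_all add: mult.assoc)

lemma coef_tensor_power_append:
  assumes "length u1 = a" "length u2 = a" "length u3 = a"
  shows "coef (tensor_power t (a + b)) (u1 @ v1) (u2 @ v2) (u3 @ v3)
    = coef (tensor_power t a) u1 u2 u3 * coef (tensor_power t b) v1 v2 v3"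
  using assms by (simp add: prod_lessThan_add nth_append)

text \<open>Both zeroth powers are the scalar 1 on the empty word. This starts the induction by
  which all powers can be reached once the first one can.\<close>

lemma tensor_power_restricts_0: "tensor_power t 0 \<succeq> tensor_power s 0"
  unfolding restricts_to_def
proof (intro exI ballI)
  fix x y z
  have "{xs :: 'a list. length xs = 0 \<and> set xs \<subseteq> A} = {[]}" for A by auto
  then show "(\<Sum>i\<in>idx1 (tensor_power t 0). \<Sum>j\<in>idx2 (tensor_power t 0). \<Sum>k\<in>idx3 (tensor_power t 0).
      1 * 1 * 1 * coef (tensor_power t 0) i j k) = coef (tensor_power s 0) x y z"
    by simp
qed

text \<open>Restrictions can be tensored with each other. This makes the least exponent subadditive
  in \<open>n\<close>, as Fekete's lemma demands.\<close>

lemma tensor_power_restricts_add: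
  fixes t :: "('a, 'f::field) tensor3" and s :: "('b, 'f) tensor3"
  assumes "tensor_power t a \<succeq> tensor_power s n" "tensor_power t b \<succeq> tensor_power s k"
  shows "tensor_power t (a + b) \<succeq> tensor_power s (n + k)"
proof -
  define X where "X m = idx1 (tensor_power t m)" for m
  define Y where "Y m = idx2 (tensor_power t m)" for m
  define Z where "Z m = idx3 (tensor_power t m)" for m
  from assms(1) obtain A1 A2 A3 where A [rule_format]:
      "\<forall>x\<in>idx1 (tensor_power s n). \<forall>y\<in>idx2 (tensor_power s n). \<forall>z\<in>idx3 (tensor_power s n).
      (\<Sum>i\<in>X a. \<Sum>j\<in>Y a. \<Sum>k\<in>Z a. A1 x i * A2 y j * A3 z k * coef (tensor_power t a) i j k)
        = coef (tensor_power s n) x y z"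
    unfolding restricts_to_def X_def Y_def Z_def by (elim exE)
  from assms(2) obtain B1 B2 B3 where B [rule_format]:
      "\<forall>x\<in>idx1 (tensor_power s k). \<forall>y\<in>idx2 (tensor_power s k). \<forall>z\<in>idx3 (tensor_power s k).
      (\<Sum>i\<in>X b. \<Sum>j\<in>Y b. \<Sum>k\<in>Z b. B1 x i * B2 y j * B3 z k * coef (tensor_power t b) i j k)
        = coef (tensor_power s k) x y z"
    unfolding restricts_to_def X_def Y_def Z_def by (elim exE)
  \<comment> \<open>The Kronecker product of two matrices: words are cut after \<open>n\<close>
    letters on the target side and after \<open>a\<close> letters on the source side.\<close>
  define C where "C A B x i = A (take n x) (take a i) * B (drop n x) (drop a i)"
    for A B :: "'b list \<Rightarrow> 'a list \<Rightarrow> 'f" and x i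
  have "(\<Sum>i\<in>X (a + b). \<Sum>j\<in>Y (a + b). \<Sum>l\<in>Z (a + b).
      C A1 B1 x i * C A2 B2 y j * C A3 B3 z l * coef (tensor_power t (a + b)) i j l)
    = coef (tensor_power s (n + k)) x y z" (is "?lhs = ?rhs")
    if "x \<in> idx1 (tensor_power s (n + k))" "y \<in> idx2 (tensor_power s (n + k))"
      "z \<in> idx3 (tensor_power s (n + k))" for x y z
  proof -
    define F where "F = (\<lambda>(i, j, l). A1 (take n x) i * A2 (take n y) j * A3 (take n z) l *
      coef (tensor_power t a) i j l)"
    define G where "G = (\<lambda>(i, j, l). B1 (drop n x) i * B2 (drop n y) j * B3 (drop n z) l *
      coef (tensor_power t b) i j l)"
    have "?lhs = (\<Sum>(i, j, l)\<in>X (a + b) \<times> Y (a + b) \<times> Z (a + b).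
        C A1 B1 x i * C A2 B2 y j * C A3 B3 z l * coef (tensor_power t (a + b)) i j l)"
      by (simp add: sum.cartesian_product)
    also have "\<dots> = (\<Sum>(u, v)\<in>(X a \<times> Y a \<times> Z a) \<times> (X b \<times> Y b \<times> Z b). F u * G v)"
    proof (rule sum.reindex_bij_witness[of _
          "\<lambda>((u1, u2, u3), (v1, v2, v3)). (u1 @ v1, u2 @ v2, u3 @ v3)"
          "\<lambda>(i, j, l). ((take a i, take a j, take a l), (drop a i, drop a j, drop a l))"])
      fix p assume p: "p \<in> X (a + b) \<times> Y (a + b) \<times> Z (a + b)"
      obtain i j l where [simp]: "p = (i, j, l)" by (cases p)
      have "length (take a i) = a" "length (take a j) = a" "length (take a l) = a"
        using p by (auto simp: X_def Y_def Z_def)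
      from coef_tensor_power_append[OF this, of t b "drop a i" "drop a j" "drop a l"]
      have coef: "coef (tensor_power t (a + b)) i j l = coef (tensor_power t a) (take a i) (take a j) (take a l)
          * coef (tensor_power t b) (drop a i) (drop a j) (drop a l)"
        unfolding append_take_drop_id .
      show "(case case p of (i, j, l) \<Rightarrow> ((take a i, take a j, take a l), drop a i, drop a j, drop a l) of
         (u, v) \<Rightarrow> F u * G v) =
        (case p of (i, j, l) \<Rightarrow> C A1 B1 x i * C A2 B2 y j * C A3 B3 z l * coef (tensor_power t (a + b)) i j l)"
        unfolding \<open>p = (i, j, l)\<close> prod.case coef by (simp add: F_def G_def C_def del: tensor_power_simps)
    qed (auto simp: X_def Y_def Z_def dest: in_set_takeD in_set_dropD)
    also have "\<dots> = (\<Sum>u\<in>X a \<times> Y a \<times> Z a. F u) * (\<Sum>v\<in>X b \<times> Y b \<times> Z b. G v)"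
      by (simp add: sum_product sum.cartesian_product)
    also have "(\<Sum>u\<in>X a \<times> Y a \<times> Z a. F u) = coef (tensor_power s n) (take n x) (take n y) (take n z)"
      unfolding F_def using that
      by (subst A[symmetric]) (auto simp: sum.cartesian_product dest: in_set_takeD)
    also have "(\<Sum>v\<in>X b \<times> Y b \<times> Z b. G v) = coef (tensor_power s k) (drop n x) (drop n y) (drop n z)"
      unfolding G_def using that
      by (subst B[symmetric]) (auto simp: sum.cartesian_product dest: in_set_dropD)
    also have "coef (tensor_power s n) (take n x) (take n y) (take n z) * \<dots> = ?rhs"
      using that
      by (subst coef_tensor_power_append[symmetric]) auto
    finally show ?thesis .
  qed
  then show ?thesis unfolding restricts_to_def X_def Y_def Z_def
    by (intro exI[of _ "C A1 B1"] exI[of _ "C A2 B2"] exI[of _ "C A3 B3"] ballI)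
qed

text \<open>Freezing the last \<open>n\<close> positions at one support entry leaves the first power
  times the nonzero scalar \<open>c\<close>, which is divided out of \<open>A1\<close>. Thus an
  unreachable first power makes all positive powers unreachable.\<close>

lemma restricts_tensor_power_1:
  fixes s :: "('b, 'f::field) tensor3"
  assumes "t \<succeq> tensor_power s (Suc n)"
    and "i \<in> idx1 s" "j \<in> idx2 s" "k \<in> idx3 s" "coef s i j k \<noteq> 0"
  shows "t \<succeq> tensor_power s 1"
proof -
  from assms(1) obtain A1 A2 A3 where A [rule_format]:
      "\<forall>x\<in>idx1 (tensor_power s (Suc n)). \<forall>y\<in>idx2 (tensor_power s (Suc n)). \<forall>z\<in>idx3 (tensor_power s (Suc n)).
      (\<Sum>i\<in>idx1 t. \<Sum>j\<in>idx2 t. \<Sum>k\<in>idx3 t. A1 x i * A2 y j * A3 z k * coef t i j k)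
        = coef (tensor_power s (Suc n)) x y z"
    unfolding restricts_to_def by (elim exE)
  define c where "c = coef s i j k ^ n"
  have c: "c \<noteq> 0" using assms(5) by (simp add: c_def)
  let ?r = "\<lambda>x i. x @ replicate n i"
  have "(\<Sum>i'\<in>idx1 t. \<Sum>j'\<in>idx2 t. \<Sum>k'\<in>idx3 t.
      (A1 (?r x i) i' / c) * A2 (?r y j) j' * A3 (?r z k) k' * coef t i' j' k') = coef (tensor_power s 1) x y z"
    if "x \<in> idx1 (tensor_power s 1)" "y \<in> idx2 (tensor_power s 1)" "z \<in> idx3 (tensor_power s 1)" for x y z
  proof -
    have "(\<Sum>i'\<in>idx1 t. \<Sum>j'\<in>idx2 t. \<Sum>k'\<in>idx3 t.
        (A1 (?r x i) i' / c) * A2 (?r y j) j' * A3 (?r z k) k' * coef t i' j' k')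
      = (\<Sum>i'\<in>idx1 t. \<Sum>j'\<in>idx2 t. \<Sum>k'\<in>idx3 t.
        A1 (?r x i) i' * A2 (?r y j) j' * A3 (?r z k) k' * coef t i' j' k') / c"
      by (simp add: sum_divide_distrib)
    also have "\<dots> = coef (tensor_power s (1 + n)) (?r x i) (?r y j) (?r z k) / c"
      using that assms(2-4) by (subst A) auto
    also have "\<dots> = coef (tensor_power s 1) x y z"
      using that c by (subst coef_tensor_power_append) (auto simp: c_def)
    finally show ?thesis .
  qed
  then show ?thesis unfolding restricts_to_def
    by (intro exI[of _ "\<lambda>x i'. A1 (?r x i) i' / c"] exI[of _ "\<lambda>y. A2 (?r y j)"] exI[of _ "\<lambda>z. A3 (?r z k)"] ballI)
qed

section \<open>Fekete's lemma and the limit in the relative exponent\<close>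

text \<open>Fekete's lemma.\<close>

lemma subadditive_convergent:
  fixes f :: "nat \<Rightarrow> real"
  assumes sub: "\<And>m n. f (m + n) \<le> f m + f n" and nonneg: "\<And>n. 0 \<le> f n"
  shows "convergent (\<lambda>n. f n / real n)"
proof -
  \<comment> \<open>The infimum starts at 1 because the quotient at 0 is 0 by convention and would
    force the infimum to be 0.\<close>
  define L where "L = (INF n\<in>{1..}. f n / real n)"
  have bdd: "bdd_below ((\<lambda>n. f n / real n) ` {1..})"
    using nonneg by (intro bdd_belowI[of _ 0]) auto
  have "(\<lambda>n. f n / real n) \<longlonglongrightarrow> L"
  proof (rule order_tendstoI)
    fix a assume "a < L"
    then show "eventually (\<lambda>n. a < f n / real n) sequentially"
      using cINF_lower[OF bdd] unfolding L_def eventually_sequentially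
      by (intro exI[of _ 1]) (meson atLeast_iff less_le_trans)
  next
    fix a assume "L < a"
    then obtain k where k: "k \<ge> 1" "f k / real k < a"
      unfolding L_def using cINF_less_iff[OF _ bdd] by auto
    \<comment> \<open>Dividing \<open>n\<close> by \<open>k\<close> with remainder, \<open>K\<close>
      bounds the contribution of the remainder, which becomes negligible after division by
      \<open>n\<close>.\<close>
    define K where "K = Max (f ` {..<k})"
    have mult: "f (d * k + r) \<le> real d * f k + f r" for d r
    proof (induction d)
      case (Suc d)
      have "f (Suc d * k + r) \<le> f k + f (d * k + r)" using sub[of k "d * k + r"] by (simp add: add.assoc)
      then show ?case using Suc by (simp add: algebra_simps)
    qed simp
    have bound: "f n / real n \<le> f k / real k + K / real n" if "n \<ge> 1" for n
    proof -
      have "f (n mod k) \<le> K" using k by (auto simp: K_def intro!: Max_ge)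
      moreover have "f n \<le> real (n div k) * f k + f (n mod k)" using mult[of "n div k" "n mod k"] by simp
      moreover have "real (n div k) * f k \<le> real n / real k * f k"
        using nonneg[of k] by (intro mult_right_mono of_nat_div_le_of_nat)
      ultimately have "f n \<le> real n * (f k / real k) + K" by simp
      then show ?thesis using that by (simp add: field_simps)
    qed
    have "(\<lambda>n. f k / real k + K / real n) \<longlonglongrightarrow> f k / real k + 0"
      by (intro tendsto_intros lim_const_over_n)
    then have "eventually (\<lambda>n. f k / real k + K / real n < a) sequentially"
      using k(2) by (intro order_tendstoD(2)[where y = "f k / real k + 0"]) auto
    then show "eventually (\<lambda>n. f n / real n < a) sequentially"
      using eventually_ge_at_top[of 1] by eventually_elim (use bound in fastforce)
  qed
  then show ?thesis by (rule convergentI)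
qed

lemma INF_ereal_nat:
  assumes "P \<noteq> {}"
  shows "(INF m\<in>P. ereal (real m)) = ereal (real (Inf P))"
proof (rule antisym)
  show "(INF m\<in>P. ereal (real m)) \<le> ereal (real (Inf P))"
    using Inf_nat_def1[OF assms] by (rule INF_lower)
  show "ereal (real (Inf P)) \<le> (INF m\<in>P. ereal (real m))"
    by (intro INF_greatest) (auto intro: cInf_lower)
qed

text \<open>The value of \<open>lim\<close> is informative only for a convergent sequence, so
  convergence comes first: the quotients are either \<open>\<infinity>\<close> for all positive
  \<open>n\<close>, or finite and covered by Fekete's lemma. The slack \<open>d\<close> disappears
  in the limit.\<close>

lemma relative_exponent_ge:
  fixes t :: "('a, 'f::field) tensor3" and s :: "('b, 'f) tensor3"
  assumes nonzero: "i \<in> idx1 s" "j \<in> idx2 s" "k \<in> idx3 s" "coef s i j k \<noteq> 0"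
    and bound: "\<And>m n. tensor_power t m \<succeq> tensor_power s n \<Longrightarrow> c * real n - d \<le> real m"
  shows "ereal c \<le> relative_exponent t s"
proof -
  define P where "P n = {m. tensor_power t m \<succeq> tensor_power s n}" for n
  let ?e = "\<lambda>n. (INF m\<in>P n. ereal (real m)) / ereal (real n)"
  have re: "relative_exponent t s = lim ?e" by (simp add: relative_exponent_def P_def)
  have add: "a + b \<in> P (n + l)" if "a \<in> P n" "b \<in> P l" for a b n l
    using that tensor_power_restricts_add unfolding P_def by blast
  have P0: "0 \<in> P 0" using tensor_power_restricts_0 by (simp add: P_def)
  show ?thesis
  proof (cases "P 1 = {}")
    case True
    have empty: "P n = {}" if "n \<ge> 1" for n
      using that True restricts_tensor_power_1[OF _ nonzero] unfolding P_def
      by (cases n) auto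
    have "eventually (\<lambda>n. ?e n = \<infinity>) sequentially"
      using eventually_ge_at_top[of 1] by eventually_elim (simp add: empty top_ereal_def)
    then have "?e \<longlonglongrightarrow> \<infinity>" by (rule tendsto_eventually)
    then show ?thesis unfolding re by (simp add: limI)
  next
    case False
    then obtain a where a: "a \<in> P 1" by blast
    have ne: "P n \<noteq> {}" for n
    proof (induction n)
      case (Suc n)
      then show ?case using add[OF _ a, of _ n] by fastforce
    qed (use P0 in blast)
    define M where "M n = Inf (P n)" for n
    have M: "M n \<in> P n" for n unfolding M_def using ne by (rule Inf_nat_def1)
    have "M (n + l) \<le> M n + M l" for n l
      unfolding M_def[of "n + l"] using add[OF M M] by (intro cInf_lower) auto
    then have "convergent (\<lambda>n. real (M n) / real n)"
      by (intro subadditive_convergent) (auto simp flip: of_nat_add)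
    then obtain L where L: "(\<lambda>n. real (M n) / real n) \<longlonglongrightarrow> L" by (auto simp: convergent_def)
    have e: "?e n = ereal (real (M n) / real n)" if "n \<ge> 1" for n
      using that INF_ereal_nat[OF ne] by (simp add: M_def)
    have "eventually (\<lambda>n. ereal (real (M n) / real n) = ?e n) sequentially"
      using eventually_ge_at_top[of 1] by eventually_elim (simp only: e)
    then have "?e \<longlonglongrightarrow> ereal L"
      using L by (intro Lim_transform_eventually[OF tendsto_ereal])
    then have "relative_exponent t s = ereal L" unfolding re by (rule limI)
    moreover have "c \<le> L"
    proof (rule LIMSEQ_le)
      have "(\<lambda>n. c - d / real n) \<longlonglongrightarrow> c - 0" by (intro tendsto_intros lim_const_over_n)
      then show "(\<lambda>n. c - d / real n) \<longlonglongrightarrow> c" by simp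
      have "c - d / real n \<le> real (M n) / real n" if "n \<ge> 1" for n
      proof -
        have "(c * real n - d) / real n \<le> real (M n) / real n"
          using bound M[of n] by (intro divide_right_mono) (auto simp: P_def)
        then show ?thesis using that by (simp add: diff_divide_distrib)
      qed
      then show "\<exists>N. \<forall>n\<ge>N. c - d / real n \<le> real (M n) / real n" by blast
    qed (rule L)
    ultimately show ?thesis by simp
  qed
qed

section \<open>Unit tensors and the subrank of tensor powers\<close>

lemma unit_tensor_simps [simp]:
  "idx1 (unit_tensor n) = {1..n}" "idx2 (unit_tensor n) = {1..n}" "idx3 (unit_tensor n) = {1..n}"
  by (simp_all add: unit_tensor_def)

lemma coef_unit_tensor:
  assumes "a \<in> {1..n}"
  shows "coef (unit_tensor n :: (nat, 'f::field) tensor3) a b c = (if a = b \<and> b = c then 1 else 0)"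
proof -
  have "coef (unit_tensor n :: (nat, 'f) tensor3) a b c
      = (\<Sum>i=1..n. if i = a then (if a = b \<and> b = c then 1 else 0) else 0)"
    unfolding unit_tensor_def tensor3.simps
    by (rule sum.cong) (auto simp: basis_tensor_def basis_vec_def)
  then show ?thesis using assms by (simp add: sum.delta)
qed

lemma coef_tensor_power_unit_tensor:
  assumes "length xs = n" "set xs \<subseteq> {1..r}" "length ys = n" "length zs = n"
  shows "coef (tensor_power (unit_tensor r :: (nat, 'f::field) tensor3) n) xs ys zs
    = (if xs = ys \<and> ys = zs then 1 else 0)"
proof -
  have "coef (unit_tensor r) (xs ! l) (ys ! l) (zs ! l) = (if xs ! l = ys ! l \<and> ys ! l = zs ! l then 1 else 0 :: 'f)"
    if "l < n" for l
    using assms(1,2) that by (intro coef_unit_tensor) (use nth_mem in fastforce)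
  then have "coef (tensor_power (unit_tensor r :: (nat, 'f) tensor3) n) xs ys zs
      = (\<Prod>l<n. if xs ! l = ys ! l \<and> ys ! l = zs ! l then 1 else 0)"
    unfolding tensor_power_simps by (intro prod.cong) simp_all
  also have "\<dots> = (if \<forall>l<n. xs ! l = ys ! l \<and> ys ! l = zs ! l then 1 else 0)"
    by (auto simp: prod_zero_iff)
  also have "\<dots> = (if xs = ys \<and> ys = zs then 1 else 0)"
    using assms by (auto simp: list_eq_iff_nth_eq)
  finally show ?thesis .
qed

text \<open>A weighting whose product is at least 1 on the support of \<open>t\<close> multiplies along words,
  so every nonzero entry of the power lies in a slice indexed by a word of weight at least 1,
  and Markov's inequality counts these words.\<close>

lemma subrank_tensor_power_le:
  fixes t :: "('a, 'f::field) tensor3" and g :: "'a \<Rightarrow> real"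
  assumes "tensor_power t m \<succeq> tensor_power (unit_tensor r) n"
    and fin: "finite I" and idx: "idx1 t = I" "idx2 t = I" "idx3 t = I"
    and pos: "\<And>a. 0 \<le> g a"
    and supp: "\<And>a b c. a \<in> I \<Longrightarrow> b \<in> I \<Longrightarrow> c \<in> I \<Longrightarrow> coef t a b c \<noteq> 0 \<Longrightarrow> 1 \<le> g a * g b * g c"
  shows "real r ^ n \<le> 3 * sum g I ^ m"
proof -
  define w where "w xs = prod_list (map g xs)" for xs
  have w0: "0 \<le> w xs" for xs unfolding w_def using pos by (induction xs) auto
  have w_nth: "w xs = (\<Prod>l<m. g (xs ! l))" if "length xs = m" for xs
    using that by (simp add: w_def prod.list_conv_set_nth atLeast0LessThan)
  define V where "V = {xs. length xs = m \<and> set xs \<subseteq> I}"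
  have finV: "finite V" unfolding V_def using fin by (rule finite_lists_length)
  define W where "W = {xs. length xs = n \<and> set xs \<subseteq> {1..r}}"
  have "card W \<le> card {x\<in>idx1 (tensor_power t m). 1 \<le> w x} + card {x\<in>idx2 (tensor_power t m). 1 \<le> w x}
      + card {x\<in>idx3 (tensor_power t m). 1 \<le> w x}"
  proof (rule card_diagonal_le_slices[OF assms(1)])
    show "coef (tensor_power (unit_tensor r) n) x y z = (if x = y \<and> y = z then 1 else 0)"
      if "x \<in> W" "y \<in> W" "z \<in> W" for x y z
      using that by (intro coef_tensor_power_unit_tensor) (auto simp: W_def)
  next
    fix x y z
    assume xyz: "x \<in> idx1 (tensor_power t m)" "y \<in> idx2 (tensor_power t m)" "z \<in> idx3 (tensor_power t m)"
      and nz: "coef (tensor_power t m) x y z \<noteq> 0"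
    have "1 \<le> (\<Prod>l<m. g (x ! l) * g (y ! l) * g (z ! l))"
    proof (rule prod_ge_1)
      fix l assume "l \<in> {..<m}"
      then show "1 \<le> g (x ! l) * g (y ! l) * g (z ! l)"
        using xyz nz by (intro supp) (auto simp: idx prod_zero_iff subset_iff)
    qed
    then have "1 \<le> w x * w y * w z" using xyz by (simp add: w_nth prod.distrib)
    \<comment> \<open>Three nonnegative weights below 1 have a product below 1, so one of the three
      words must be heavy.\<close>
    moreover have "w x * w y * w z < 1" if "w x < 1" "w y < 1" "w z < 1"
    proof -
      have "w x * w y \<le> 1" using that w0 by (intro mult_le_one) auto
      then have "w x * w y * w z \<le> w z" using w0 by (intro mult_left_le_one_le) auto
      then show ?thesis using that by simp
    qed
    ultimately show "1 \<le> w x \<or> 1 \<le> w y \<or> 1 \<le> w z" by linarith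
  qed (use finV in \<open>auto simp: V_def W_def idx finite_lists_length\<close>)
  then have "card W \<le> 3 * card {x\<in>V. 1 \<le> w x}" by (simp add: idx V_def)
  moreover have "card W = r ^ n" by (simp add: W_def card_lists_length)
  moreover have "real (card {x\<in>V. 1 \<le> w x}) \<le> sum w V"
  proof -
    have "real (card {x\<in>V. 1 \<le> w x}) = (\<Sum>x\<in>{x\<in>V. 1 \<le> w x}. 1)" by simp
    also have "\<dots> \<le> (\<Sum>x\<in>{x\<in>V. 1 \<le> w x}. w x)" by (rule sum_mono) simp
    also have "\<dots> \<le> sum w V" using finV w0 by (intro sum_mono2) auto
    finally show ?thesis .
  qed
  moreover have "sum w V = sum g I ^ m" unfolding V_def w_def by (rule sum_lists_prod_list)
  ultimately show ?thesis by (simp flip: of_nat_power)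
qed

section \<open>The small Coppersmith-Winograd tensor\<close>

lemma cw_simps [simp]: "idx1 (cw q) = {0..q}" "idx2 (cw q) = {0..q}" "idx3 (cw q) = {0..q}"
  by (simp_all add: cw_def)

lemma coef_cw:
  assumes "a \<le> q" "b \<le> q" "c \<le> q"
  shows "coef (cw q :: (nat, 'f::field) tensor3) a b c =
    (if a = 0 \<and> b = c \<and> b \<noteq> 0 \<or> b = 0 \<and> a = c \<and> a \<noteq> 0 \<or> c = 0 \<and> a = b \<and> a \<noteq> 0 then 1 else 0)"
proof -
  have *: "(\<Sum>i=1..q. if i = x \<and> Q then 1 else 0) = (if x \<noteq> 0 \<and> Q then 1 else 0 :: 'f)"
    if "x \<le> q" for x Q
    using that by (cases Q) (auto simp: sum.delta)
  have "coef (cw q :: (nat, 'f) tensor3) a b c = (\<Sum>i=1..q. (if i = b \<and> a = 0 \<and> b = c then 1 else 0) +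
      (if i = a \<and> b = 0 \<and> a = c then 1 else 0) + (if i = a \<and> c = 0 \<and> a = b then 1 else 0))"
    unfolding cw_def tensor3.simps by (intro sum.cong) (auto simp: basis_tensor_def basis_vec_def)
  also have "\<dots> = (if b \<noteq> 0 \<and> a = 0 \<and> b = c then 1 else 0) + (if a \<noteq> 0 \<and> b = 0 \<and> a = c then 1 else 0)
      + (if a \<noteq> 0 \<and> c = 0 \<and> a = b then 1 else 0)"
    unfolding sum.distrib using assms by (simp only: *)
  \<comment> \<open>Each of the three cases has exactly one index equal to 0, at a different
    position. They exclude each other, so no \<open>1 + 1\<close> arises and the characteristic of
    the field does not matter.\<close>
  finally show ?thesis by auto
qed

text \<open>Every row of the first flattening of \<open>cw q\<close> has a unit-vector column:
  \<open>(1, 1)\<close> for row 0 and \<open>(0, a)\<close> for a row \<open>a > 0\<close>. Choosing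
  these letter by letter gives the pivot column \<open>(y, z)\<close> of a word
  \<open>x\<close>.\<close>

lemma rank_tensor_power_cw_ge:
  assumes "q \<ge> 1" and "tensor_power (unit_tensor r) m \<succeq> tensor_power (cw q :: (nat, 'f::field) tensor3) n"
  shows "(q + 1) ^ n \<le> r ^ m"
proof -
  let ?s = "tensor_power (cw q :: (nat, 'f) tensor3) n"
  have "card (idx1 ?s) \<le> card (idx1 (tensor_power (unit_tensor r :: (nat, 'f) tensor3) m))"
  proof (rule card_idx1_le_of_restricts[OF assms(2)])
    fix x assume x: "x \<in> idx1 ?s"
    define y where "y = map (\<lambda>a. if a = 0 then 1 else 0 :: nat) x"
    define z where "z = map (\<lambda>a. if a = 0 then 1 else a) x"
    have coef: "coef (cw q) (x' ! l) (y ! l) (z ! l) = (if x' ! l = x ! l then 1 else 0 :: 'f)"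
      if "x' \<in> idx1 ?s" "l < n" for x' l
    proof -
      have "x ! l \<le> q" "x' ! l \<le> q" using x that by (auto simp: subset_iff)
      then show ?thesis using assms(1) x that(2) by (subst coef_cw) (auto simp: y_def z_def)
    qed
    have "coef ?s x y z \<noteq> 0" using coef[OF x] by simp
    moreover have "coef ?s x' y z = 0" if "x' \<in> idx1 ?s" "x' \<noteq> x" for x'
    proof -
      have "length x' = n" "length x = n" using that x by auto
      then obtain l where "l < n" "x' ! l \<noteq> x ! l"
        using \<open>x' \<noteq> x\<close> nth_equalityI[of x' x] by metis
      then show ?thesis using coef[OF that(1)] by (auto simp: prod_zero_iff)
    qed
    moreover have "y \<in> idx2 ?s" "z \<in> idx3 ?s"
      using x assms(1) by (auto simp: y_def z_def)
    ultimately show "\<exists>y\<in>idx2 ?s. \<exists>z\<in>idx3 ?s. coef ?s x y z \<noteq> 0 \<and>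
      (\<forall>x'\<in>idx1 ?s. x' \<noteq> x \<longrightarrow> coef ?s x' y z = 0)" by blast
  qed (auto simp: finite_lists_length)
  then show ?thesis by (simp add: card_lists_length)
qed

theorem theorem4p4:
  fixes q :: nat
  assumes "q \<ge> 1"
  shows "2 * irr (cw q :: (nat, 'f::field) tensor3)
    \<ge> ereal (2 * log 2 (real q + 1) / (log 2 3 - 2/3 + 2/3 * log 2 (real q)))"
proof -
  let ?t = "cw q :: (nat, 'f) tensor3"
  define \<beta> where "\<beta> = log 2 3 - 2/3 + 2/3 * log 2 (real q)"
  \<comment> \<open>Positivity of \<open>\<beta>\<close>, needed to divide by it, comes from
    \<open>log 2 3\<close> exceeding 2/3.\<close>
  have "1 \<le> log 2 (3::real)" by simp
  moreover have "0 \<le> log 2 (real q)" using assms by simp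
  ultimately have \<beta>: "\<beta> > 0" unfolding \<beta>_def by linarith
  have rank: "ereal (log 2 (real q + 1)) \<le> relative_exponent (unit_tensor 2) ?t"
  proof (rule relative_exponent_ge[where d = 0])
    show "coef ?t 0 1 1 \<noteq> 0" using assms by (subst coef_cw) auto
    fix m n assume "tensor_power (unit_tensor 2) m \<succeq> tensor_power ?t n"
    then have "real ((q + 1) ^ n) \<le> real (2 ^ m)"
      using rank_tensor_power_cw_ge[OF assms] of_nat_le_iff by blast
    then have "log 2 ((real q + 1) ^ n) \<le> log 2 (2 ^ m)" by (subst log_le_cancel_iff) (auto simp: add.commute)
    then show "log 2 (real q + 1) * real n - 0 \<le> real m" by (simp add: log_nat_power mult.commute)
  qed (use assms in auto)
  have subrank: "ereal (1 / \<beta>) \<le> relative_exponent ?t (unit_tensor 2)"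
  \<comment> \<open>The slack stems from the factor 3 in the slice count, one for each direction of
    slicing.\<close>
  proof (rule relative_exponent_ge[where d = "log 2 3 / \<beta>" and i = 1 and j = 1 and k = 1])
    show "coef (unit_tensor 2 :: (nat, 'f) tensor3) 1 1 1 \<noteq> 0" by (subst coef_unit_tensor) auto
    fix m n assume "tensor_power ?t m \<succeq> tensor_power (unit_tensor 2) n"
    \<comment> \<open>This \<open>u\<close> minimises \<open>u^2 + q / u\<close>: the derivative
      vanishes when \<open>u^3 = q / 2\<close>. There \<open>q / u = 2 * u^2\<close>, so the minimum
      is \<open>3 * u^2\<close>.\<close>
    define u where "u = (real q / 2) powr (1/3)"
    have u: "u > 0" using assms by (simp add: u_def)
    have u3: "u ^ 3 = real q / 2"
      using assms by (simp add: u_def powr_powr flip: powr_realpow)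
    have log_u: "log 2 u = (log 2 (real q) - 1) / 3"
      using assms by (simp add: u_def log_powr log_divide)
    define g where "g a = (if a = 0 then u ^ 2 else 1 / u)" for a :: nat
    have "real 2 ^ n \<le> 3 * sum g {0..q} ^ m"
    proof (rule subrank_tensor_power_le[OF \<open>tensor_power ?t m \<succeq> _\<close>])
      fix a b c assume "a \<in> {0..q}" "b \<in> {0..q}" "c \<in> {0..q}" "coef ?t a b c \<noteq> 0"
      then show "1 \<le> g a * g b * g c"
        using u by (auto simp: coef_cw g_def power2_eq_square split: if_splits)
    qed (use u in \<open>auto simp: g_def\<close>)
    moreover have "sum g {0..q} = 3 * u ^ 2"
    proof -
      have "sum g {0..q} = g 0 + sum g {1..q}" by (simp add: sum.atLeast_Suc_atMost)
      also have "sum g {1..q} = real q / u" by (simp add: g_def)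
      also have "real q = 2 * u ^ 3" using u3 by simp
      finally show ?thesis using u by (simp add: g_def power3_eq_cube power2_eq_square)
    qed
    ultimately have "log 2 (2 ^ n) \<le> log 2 (3 * (3 * u ^ 2) ^ m)" using u by (subst log_le_cancel_iff) auto
    also have "\<dots> = log 2 3 + real m * (log 2 3 + 2 * log 2 u)"
      using u by (simp add: log_mult log_nat_power distrib_left)
    \<comment> \<open>Here the denominator takes its form: the summand \<open>2 * log 2 u\<close>
      contributes \<open>- 2/3 + 2/3 * log 2 q\<close>.\<close>
    also have "log 2 3 + 2 * log 2 u = \<beta>" by (simp add: log_u \<beta>_def field_simps)
    finally show "1 / \<beta> * real n - log 2 3 / \<beta> \<le> real m" using \<beta> by (simp add: field_simps)
  qed auto
  \<comment> \<open>Both lower bounds are nonnegative, so they may be multiplied in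
    \<open>ereal\<close> even if a factor of \<open>irr\<close> is infinite.\<close>
  have "ereal (log 2 (real q + 1)) * ereal (1 / \<beta>) \<le> irr ?t"
    unfolding irr_def
    using rank subrank \<beta> order_trans[OF _ rank, of 0] by (intro ereal_mult_mono) auto
  then have "2 * (ereal (log 2 (real q + 1)) * ereal (1 / \<beta>)) \<le> 2 * irr ?t"
    by (intro ereal_mult_left_mono) auto
  moreover have "2 * (ereal (log 2 (real q + 1)) * ereal (1 / \<beta>)) = ereal (2 * log 2 (real q + 1) / \<beta>)"
    unfolding numeral_eq_ereal by simp
  ultimately show ?thesis unfolding \<beta>_def by simp
qed

end
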